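(* Let $\{\Psi_n(x)\mid n\ge 0\}$ be the family of polynomials defined by $$\exp\left[x f(z)\right]=\sum_{n=0}^{\infty}\Psi_n(x)\frac{z^n}{n!}.$$ If this family satisfies a three-term recurrence relation of the form $$\Psi_{n+1}(x)=(A_nx+B_n)\Psi_n(x)-C_n\Psi_{n-1}(x),\qquad n\ge 0,$$ with $\Psi_{-1}(x)=0$ and $\Psi_0(x)=1$, then $$f(z)=\frac{2a}{\sqrt{b^2-4c}}\left[\operatorname{arctanh}\left(\frac{b-2cz}{\sqrt{b^2-4c}}\right)-\operatorname{arctanh}\left(\frac{b}{\sqrt{b^2-4c}}\right)\right]$$ and $$A_n=a,\qquad B_n=nb,\qquad C_n=cn(n-1),$$ with $a\neq 0$ and $c>0$. The recurrence relation takes the form $$\Psi_{n+1}(x)=(ax+nb)\Psi_n(x)-cn(n-1)\Psi_{n-1}(x),\qquad n\ge 0.$$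
   Context: Here $a,b,c$ are constants, with $a=f'(0)$ and $b=f''(0)/f'(0)$. Equivalently, $f(z)=\frac{a}{\sqrt{b^2-4c}}\ln\left[\frac{1-zR^-}{1-zR^+}\right]$ with $R^{\pm}=\frac12\left[b\pm\sqrt{b^2-4c}\right]$. When $b^2=4c$, the formula for $f$ is understood as its limiting value $f(z)=-\frac{2a}{b}\,\frac{\frac b2 z}{\frac b2 z-1}$.
   Formalization: c>0 is not concluded (false for f(z)=z, where c=0): the arctanh formula is proved for c≠0, the log formula for (b,c)≠(0,0), else f=az; a≠0 is assumed, as b=f''(0)/f'(0) requires; C_n=cn(n-1) is stated for n≥1, since C_0 multiplies Ψ_{-1}=0. *)

theory Defs
  imports "HOL-Analysis.Analysis" "HOL-Computational_Algebra.Computational_Algebra"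
begin

text \<open>
  The exponential of a formal power series with arbitrary constant term:
  the constant term is split off because formal composition is only
  meaningful for series without constant term.
\<close>
definition fps_exponential :: "real fps \<Rightarrow> real fps" where
  "fps_exponential g =
     fps_const (exp (fps_nth g 0)) * (fps_exp 1 oo (g - fps_const (fps_nth g 0)))"

text \<open>The \<open>0\<close> branch of the case expression is the convention \<open>\<Psi>\<^bsub>-1\<^esub> = 0\<close>.\<close>
definition three_term_recurrence ::
    "(nat \<Rightarrow> real poly) \<Rightarrow> (nat \<Rightarrow> real) \<Rightarrow> (nat \<Rightarrow> real) \<Rightarrow> (nat \<Rightarrow> real) \<Rightarrow> bool" where
  "three_term_recurrence \<Psi> A B C \<longleftrightarrow>
     \<Psi> 0 = 1 \<and>
     (\<forall>n. \<Psi> (Suc n) =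
        [:B n, A n:] * \<Psi> n - smult (C n) (case n of 0 \<Rightarrow> 0 | Suc m \<Rightarrow> \<Psi> m))"

text \<open>
  The closed forms are complex-valued: for \<open>c > 0\<close> the square root is imaginary or the
  arguments of \<open>artanh\<close> are real of modulus greater than \<open>1\<close>. In the latter case they lie
  on the branch cut of the principal branch used here, so a closed form is compared with
  a power series at real points near \<open>0\<close> only.
  The case \<open>b\<^sup>2 = 4 * c\<close> is the limiting value (meaningful for \<open>b \<noteq> 0\<close>).
\<close>
definition artanh_form :: "real \<Rightarrow> real \<Rightarrow> real \<Rightarrow> complex \<Rightarrow> complex" where
  "artanh_form a b c z =
     (if b\<^sup>2 = 4 * c then - (2 * a / b) * ((b / 2 * z) / (b / 2 * z - 1))
      else let s = csqrt (of_real (b\<^sup>2 - 4 * c))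
           in 2 * a / s * (artanh ((b - 2 * c * z) / s) - artanh (b / s)))"

definition log_form :: "real \<Rightarrow> real \<Rightarrow> real \<Rightarrow> complex \<Rightarrow> complex" where
  "log_form a b c z =
     (if b\<^sup>2 = 4 * c then - (2 * a / b) * ((b / 2 * z) / (b / 2 * z - 1))
      else let s = csqrt (of_real (b\<^sup>2 - 4 * c)); Rp = (b + s) / 2; Rm = (b - s) / 2
           in a / s * ln ((1 - z * Rm) / (1 - z * Rp)))"

definition equals_near_0 :: "real fps \<Rightarrow> (complex \<Rightarrow> complex) \<Rightarrow> bool" where
  "equals_near_0 f g \<longleftrightarrow>
     fps_conv_radius f > 0 \<and>
     (\<forall>\<^sub>F z in nhds (0::real). complex_of_real (eval_fps f z) = g (complex_of_real z))"

end

theory Submission imports Defs begin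

text \<open>
  Expanding the exponential in powers of \<open>x\<close> shows that the coefficient of \<open>x\<^sup>i\<close> in \<open>\<Psi>\<^sub>n\<close> is
  \<open>n!/i!\<close> times the \<open>n\<close>-th coefficient of \<open>f\<^sup>i\<close>. The three highest coefficients of \<open>\<Psi>\<^sub>n\<close>
  involve only the first three coefficients of \<open>f\<close>, and comparing them in the recurrence
  yields \<open>A\<close>, \<open>B\<close> and \<open>C\<close>. The coefficients of \<open>x\<close> in the recurrence then amount to
  the differential equation \<open>f'(z) (1 - b z + c z\<^sup>2) = a\<close>, whose solution with \<open>f(0) = 0\<close>
  is the logarithm.
\<close>

section \<open>Solving the differential equation by convergent series\<close>

lemma fps_conv_radius_deriv_le:
  fixes f :: "'a :: {banach, real_normed_field} fps"
  shows "fps_conv_radius (fps_deriv f) \<le> fps_conv_radius f"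
  unfolding fps_conv_radius_def[of f]
proof (rule conv_radius_geI_ex)
  fix r :: real assume r: "r > 0" "ereal r < fps_conv_radius (fps_deriv f)"
  define z :: 'a where "z = of_real r"
  have z: "norm z = r" using r(1) by (simp add: z_def)
  have "summable (\<lambda>n. r * norm (fps_nth (fps_deriv f) n * z ^ n))"
    using r z by (intro summable_mult norm_summable_fps) auto
  \<comment> \<open>Differentiation multiplies this coefficient by \<open>Suc n\<close>, which is at
    least 1, so the series of the derivative dominates.\<close>
  moreover have "norm (fps_nth f (Suc n) * z ^ Suc n)
      \<le> r * norm (fps_nth (fps_deriv f) n * z ^ n)" for n
  proof -
    have "1 * norm (fps_nth f (Suc n)) \<le> real (Suc n) * norm (fps_nth f (Suc n))"
      by (intro mult_right_mono) auto
    hence "(r * r ^ n) * norm (fps_nth f (Suc n)) \<le> (r * r ^ n) * (real (Suc n) * norm (fps_nth f (Suc n)))"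
      using r by (intro mult_left_mono) auto
    thus ?thesis by (simp add: norm_mult norm_power z mult_ac del: of_nat_Suc)
  qed
  ultimately have "summable (\<lambda>n. fps_nth f (Suc n) * z ^ Suc n)"
    by (rule summable_comparison_test'[where N = 0])
  hence "summable (\<lambda>n. fps_nth f n * z ^ n)"
    by (subst (asm) summable_Suc_iff)
  thus "\<exists>z. norm z = r \<and> summable (\<lambda>n. fps_nth f n * z ^ n)"
    using z by blast
qed

text \<open>The relation makes \<open>fps_deriv f\<close> a multiple of the inverse of a convergent
  series, so \<open>f\<close> converges too; on a real interval around 0, \<open>f\<close> and
  \<open>g\<close> then have equal derivatives, and both vanish at 0. The function \<open>p\<close>
  extends \<open>P\<close> to complex arguments, because \<open>g\<close> is differentiated over the
  complex numbers.\<close>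

lemma equals_near_0I:
  fixes f P :: "real fps" and g p :: "complex \<Rightarrow> complex"
  assumes ode: "fps_deriv f * P = fps_const a" and P: "fps_nth P 0 \<noteq> 0" "fps_conv_radius P > 0"
    and f0: "fps_nth f 0 = 0" and g0: "g 0 = 0"
    and p: "\<And>t. norm t < fps_conv_radius P \<Longrightarrow> p (of_real t) = of_real (eval_fps P t)"
    and g: "\<forall>\<^sub>F z in nhds 0. p z \<noteq> 0 \<and> (g has_field_derivative of_real a / p z) (at z)"
  shows "equals_near_0 f g"
proof -
  have "fps_deriv f = fps_const a * inverse P"
    using ode P by (metis fps_divide_unit nonzero_mult_div_cancel_right fps_nonzero_nth)
  hence "fps_conv_radius (fps_deriv f) \<ge> min \<infinity> (fps_conv_radius (inverse P))"
    using fps_conv_radius_mult[of "fps_const a" "inverse P"] by simp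
  moreover have "fps_conv_radius (inverse P) > 0"
    using P by (intro fps_conv_radius_inverse_pos)
  ultimately have rad': "fps_conv_radius (fps_deriv f) > 0" by auto
  hence rad: "fps_conv_radius f > 0"
    using fps_conv_radius_deriv_le[of f] by simp
  obtain e where e: "e > 0"
    "\<And>z. norm z < e \<Longrightarrow> p z \<noteq> 0 \<and> (g has_field_derivative of_real a / p z) (at z)"
    using g by (auto simp: eventually_nhds_metric dist_norm)
  obtain r :: real where r: "0 < r" "ereal r < min (ereal e) (min (fps_conv_radius f)
      (min (fps_conv_radius (fps_deriv f)) (fps_conv_radius P)))"
    using ereal_dense2[of 0 "min (ereal e) (min (fps_conv_radius f)
      (min (fps_conv_radius (fps_deriv f)) (fps_conv_radius P)))"] rad rad' P e(1)
    by (auto simp: zero_ereal_def)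
  have "of_real (eval_fps f t) = g (of_real t)" if t: "t \<in> ball 0 r" for t
  proof -
    let ?h = "\<lambda>t. of_real (eval_fps f t) - g (of_real t)"
    have "(?h has_derivative (\<lambda>_. 0)) (at t within ball 0 r)" if t: "t \<in> ball 0 r" for t
    proof -
      have tr: "ereal (norm t) < ereal r" using t by simp
      have le: "norm t < fps_conv_radius f" "norm t < fps_conv_radius (fps_deriv f)"
        "norm t < fps_conv_radius P" "norm t < e"
        using r(2) less_trans[OF tr] by (simp_all del: ereal_less(1) flip: less_ereal.simps(1))
      have "p (of_real t) \<noteq> 0" using e(2)[of "of_real t"] le by simp
      moreover have "eval_fps (fps_deriv f) t * eval_fps P t = a"
        using eval_fps_mult[of t "fps_deriv f" P] ode le by simp
      ultimately have d: "of_real (eval_fps (fps_deriv f) t) = of_real a / p (of_real t)"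
        using p[OF le(3)] by (auto simp: field_simps)
      have "(eval_fps f has_vector_derivative eval_fps (fps_deriv f) t) (at t within ball 0 r)"
        using has_field_derivative_eval_fps[OF le(1)]
        by (simp add: has_real_derivative_iff_has_vector_derivative)
      hence "((\<lambda>t. complex_of_real (eval_fps f t)) has_vector_derivative
          of_real (eval_fps (fps_deriv f) t)) (at t within ball 0 r)"
        by (rule bounded_linear.has_vector_derivative[OF bounded_linear_of_real])
      \<comment> \<open>Restricted to the real axis, \<open>g\<close> is a curve whose velocity is
        its complex derivative.\<close>
      moreover have "((\<lambda>t. g (of_real t)) has_vector_derivative
          of_real (eval_fps (fps_deriv f) t)) (at t within ball 0 r)"
        using e(2)[of "of_real t"] le d by (intro has_vector_derivative_real_field) auto
      ultimately have "(?h has_vector_derivative 0) (at t within ball 0 r)"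
        by (rule has_vector_derivative_diff[THEN has_vector_derivative_eq_rhs]) simp
      thus ?thesis by (simp add: has_vector_derivative_def)
    qed
    hence "?h t = ?h 0"
      using t r(1) by (intro has_derivative_zero_unique[of "ball 0 r" ?h]) auto
    thus ?thesis by (simp add: eval_fps_at_0 f0 g0)
  qed
  hence "\<forall>\<^sub>F t in nhds 0. complex_of_real (eval_fps f t) = g (of_real t)"
    using r(1) by (auto simp: eventually_nhds_metric intro!: exI[of _ r])
  with rad show ?thesis by (simp add: equals_near_0_def)
qed

section \<open>Coefficients of powers and of the polynomials\<close>

lemma fps_power_nth_1_mult:
  fixes g :: "'a::comm_ring_1 fps"
  shows "fps_nth (g ^ m) 1 * fps_nth g 0 = of_nat m * fps_nth g 0 ^ m * fps_nth g 1"
  by (induction m) (auto simp: fps_mult_nth_1 fps_power_zeroth algebra_simps)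

text \<open>Binomial expansion read off in degree 2. As in degree 1, multiplying by a power of
  \<open>fps_nth g 0\<close> avoids the exponents \<open>m - 1\<close> and \<open>m - 2\<close>,
  which truncate for small \<open>m\<close>.\<close>

lemma fps_power_nth_2_mult:
  fixes g :: "real fps"
  shows "fps_nth (g ^ m) 2 * fps_nth g 0 ^ 2 = fps_nth g 0 ^ m *
    (real m * fps_nth g 0 * fps_nth g 2 + real m * (real m - 1) / 2 * fps_nth g 1 ^ 2)"
proof (induction m)
  case (Suc m)
  let ?g = "fps_nth g"
  have "fps_nth (g ^ Suc m) 2 = ?g 0 * fps_nth (g ^ m) 2 + ?g 1 * fps_nth (g ^ m) 1
      + ?g 2 * ?g 0 ^ m"
    by (simp add: fps_mult_nth numeral_2_eq_2 fps_power_zeroth)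
  hence "fps_nth (g ^ Suc m) 2 * ?g 0 ^ 2 = ?g 0 * (fps_nth (g ^ m) 2 * ?g 0 ^ 2)
      + ?g 1 * ?g 0 * (fps_nth (g ^ m) 1 * ?g 0) + ?g 2 * ?g 0 ^ m * ?g 0 ^ 2"
    by (simp add: algebra_simps power2_eq_square)
  thus ?case unfolding Suc fps_power_nth_1_mult
    by (simp add: field_simps power2_eq_square)
qed simp

text \<open>Since \<open>f ^ i\<close> has no terms below degree \<open>i\<close>, the
  \<open>n\<close>-th coefficient of the exponential is a finite sum, a polynomial in
  \<open>x\<close>; it agrees with \<open>\<Psi> n\<close> at every real \<open>x\<close>, hence as
  a polynomial.\<close>

lemma coeff_of_generating_function:
  fixes f :: "real fps" and \<Psi> :: "nat \<Rightarrow> real poly"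
  assumes gen: "\<And>x. fps_exponential (fps_const x * f) = Abs_fps (\<lambda>n. poly (\<Psi> n) x / fact n)"
    and f0: "fps_nth f 0 = 0"
  shows "coeff (\<Psi> n) i = fact n / fact i * fps_nth (f ^ i) n"
proof -
  let ?p = "\<Sum>i\<le>n. monom (fact n / fact i * fps_nth (f ^ i) n) i"
  have "poly (\<Psi> n) x = poly ?p x" for x
  proof -
    have "poly (\<Psi> n) x / fact n = fps_nth (fps_exponential (fps_const x * f)) n"
      by (simp add: gen)
    also have "\<dots> = (\<Sum>i\<le>n. x ^ i * fps_nth (f ^ i) n / fact i)"
      by (simp add: fps_exponential_def f0 fps_compose_nth power_mult_distrib
          fps_const_power atLeast0AtMost)
    finally show ?thesis
      by (simp add: poly_sum poly_monom field_simps sum_distrib_left sum_divide_distrib)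
  qed
  hence "\<Psi> n = ?p" by (intro poly_eq_poly_eq_iff[THEN iffD1] ext)
  hence "coeff (\<Psi> n) i = (if i \<le> n then fact n / fact i * fps_nth (f ^ i) n else 0)"
    by (simp add: coeff_sum)
  moreover have "fps_nth (f ^ i) n = 0" if "i > n"
    using that f0 by (simp add: startsby_zero_power_prefix)
  ultimately show ?thesis by auto
qed

lemma three_term_recurrence_coeff:
  assumes "three_term_recurrence \<Psi> A B C"
  shows "coeff (\<Psi> (Suc (Suc n))) (Suc i) = A (Suc n) * coeff (\<Psi> (Suc n)) i
    + B (Suc n) * coeff (\<Psi> (Suc n)) (Suc i) - C (Suc n) * coeff (\<Psi> n) (Suc i)"
  using assms by (simp add: three_term_recurrence_def mult_pCons_left)

section \<open>The closed forms near 0\<close>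

lemma isCont_imp_tendsto_nhds: "isCont f x \<Longrightarrow> f x = y \<Longrightarrow> (f \<longlongrightarrow> y) (nhds x)"
  by (auto simp: isCont_def tendsto_at_iff_tendsto_nhds)

text \<open>If \<open>b\<^sup>2 \<noteq> 4 * c\<close>, the denominator factors as
  \<open>(1 - z * Rm) * (1 - z * Rp)\<close>, and the logarithmic derivative of the quotient of the
  factors is \<open>s\<close> over their product. Otherwise the denominator is a square, and the
  limiting form is a Moebius map.\<close>

lemma log_form_derivative:
  fixes a b c :: real
  assumes "b \<noteq> 0 \<or> c \<noteq> 0"
  shows "\<forall>\<^sub>F z::complex in nhds 0. 1 - of_real b * z + of_real c * z\<^sup>2 \<noteq> 0 \<and>
    (log_form a b c has_field_derivative of_real a / (1 - of_real b * z + of_real c * z\<^sup>2)) (at z)"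
proof (cases "b\<^sup>2 = 4 * c")
  case True
  hence b: "b \<noteq> 0" using assms by auto
  have c: "c = (b / 2)\<^sup>2" using True by (simp add: power_divide)
  have p: "1 - of_real b * z + of_real c * z\<^sup>2 = (of_real b / 2 * z - 1)\<^sup>2" for z :: complex
    unfolding c by (simp add: power2_eq_square algebra_simps)
  have "\<forall>\<^sub>F z in nhds (0::complex). of_real b / 2 * z - 1 \<noteq> 0"
    by (rule eventually_nhds_in_open[where s = "- {2 / of_real b}", THEN eventually_mono])
      (use b in \<open>auto simp: field_simps\<close>)
  thus ?thesis
  proof eventually_elim
    case (elim z)
    have "((\<lambda>z. - (2 * a / b) * ((b / 2 * z) / (b / 2 * z - 1))) has_field_derivative
        a / (of_real b / 2 * z - 1)\<^sup>2) (at z)"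
      using elim b
      by (auto intro!: derivative_eq_intros simp: field_simps power2_eq_square)
    moreover have "log_form a b c = (\<lambda>z::complex. - (2 * a / b) * ((b / 2 * z) / (b / 2 * z - 1)))"
      using True by (auto simp: log_form_def fun_eq_iff)
    ultimately show ?case using elim p by simp
  qed
next
  case False
  define s where "s = csqrt (of_real (b\<^sup>2 - 4 * c))"
  define Rp where "Rp = (of_real b + s) / 2"
  define Rm where "Rm = (of_real b - s) / 2"
  have s2: "s\<^sup>2 = of_real b ^ 2 - 4 * of_real c" by (simp add: s_def)
  have s: "s \<noteq> 0" using False unfolding s_def csqrt_eq_0 of_real_eq_0_iff by simp
  have R: "Rp - Rm = s" "Rp + Rm = of_real b" "Rp * Rm = of_real c"
    using s2 by (auto simp: Rp_def Rm_def field_simps power2_eq_square)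
  have p: "1 - of_real b * z + of_real c * z\<^sup>2 = (1 - z * Rm) * (1 - z * Rp)" for z
    unfolding R(2,3)[symmetric] by (simp add: algebra_simps power2_eq_square)
  \<comment> \<open>The quotient is 1 at 0, so by continuity it avoids the branch cut of
    \<open>ln\<close> nearby.\<close>
  have lim: "((\<lambda>z. (1 - z * Rm) / (1 - z * Rp)) \<longlongrightarrow> 1) (nhds 0)"
    "((\<lambda>z. 1 - z * Rm) \<longlongrightarrow> 1) (nhds 0)" "((\<lambda>z. 1 - z * Rp) \<longlongrightarrow> 1) (nhds 0)"
    by (rule isCont_imp_tendsto_nhds; auto intro!: continuous_intros)+
  have "\<forall>\<^sub>F z in nhds 0. (1 - z * Rm) / (1 - z * Rp) \<in> - \<real>\<^sub>\<le>\<^sub>0"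
    "\<forall>\<^sub>F z in nhds 0. 1 - z * Rm \<in> - {0}" "\<forall>\<^sub>F z in nhds 0. 1 - z * Rp \<in> - {0}"
    by (rule lim[THEN topological_tendstoD]; simp add: open_Compl)+
  thus ?thesis
  proof eventually_elim
    case (elim z)
    have nz: "1 - z * Rm \<noteq> 0" "1 - z * Rp \<noteq> 0" using elim by simp_all
    have "((\<lambda>z. a / s * ln ((1 - z * Rm) / (1 - z * Rp))) has_field_derivative
        a / s * (((- Rm) * (1 - z * Rp) - (1 - z * Rm) * (- Rp)) / ((1 - z * Rp) * (1 - z * Rp))
          / ((1 - z * Rm) / (1 - z * Rp)))) (at z)"
      using elim s by (auto intro!: derivative_eq_intros simp: mult_ac)
    also have "((- Rm) * (1 - z * Rp) - (1 - z * Rm) * (- Rp)) / ((1 - z * Rp) * (1 - z * Rp))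
          / ((1 - z * Rm) / (1 - z * Rp))
        = ((1 - z * Rm) * Rp - Rm * (1 - z * Rp)) / ((1 - z * Rm) * (1 - z * Rp))"
      using nz by simp
    also have "(1 - z * Rm) * Rp - Rm * (1 - z * Rp) = s"
      unfolding R(1)[symmetric] by (simp add: algebra_simps)
    also have "a / s * (s / ((1 - z * Rm) * (1 - z * Rp))) = a / (1 - of_real b * z + of_real c * z\<^sup>2)"
      using s by (simp add: p)
    finally have "((\<lambda>z. a / s * ln ((1 - z * Rm) / (1 - z * Rp))) has_field_derivative
        a / (1 - of_real b * z + of_real c * z\<^sup>2)) (at z)" .
    moreover have "log_form a b c = (\<lambda>z. a / s * ln ((1 - z * Rm) / (1 - z * Rp)))"
      using False by (auto simp: log_form_def fun_eq_iff Let_def s_def Rm_def Rp_def)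
    ultimately show ?case using elim p by simp
  qed
qed

lemma artanh_form_eq_log_form:
  fixes a b c :: real
  assumes c: "c \<noteq> 0"
  shows "\<forall>\<^sub>F t in nhds (0::real). artanh_form a b c (of_real t) = log_form a b c (of_real t)"
proof (cases "b\<^sup>2 = 4 * c")
  case True
  thus ?thesis by (simp add: artanh_form_def log_form_def)
next
  case False
  define s where "s = csqrt (of_real (b\<^sup>2 - 4 * c))"
  define Rp where "Rp = (of_real b + s) / 2"
  define Rm where "Rm = (of_real b - s) / 2"
  \<comment> \<open>\<open>artanh\<close> at \<open>(b - 2 c t) / s\<close> is half the logarithm of \<open>k * q t\<close>, so only the splitting of
    \<open>ln (k * q t)\<close> is at stake. If \<open>s\<close> is real, \<open>k\<close> may be on the branch cut but \<open>q t\<close> is positive;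
    if \<open>s\<close> is imaginary, \<open>k\<close> is off the cut and \<open>q t\<close> is near \<open>1\<close>.\<close>
  define k where "k = - Rp / Rm"
  define q where "q = (\<lambda>t. (1 - of_real t * Rm) / (1 - of_real t * Rp))"
  have s2: "s\<^sup>2 = of_real b ^ 2 - 4 * of_real c" by (simp add: s_def)
  have s: "s \<noteq> 0" using False unfolding s_def csqrt_eq_0 of_real_eq_0_iff by simp
  have R: "Rp * Rm = of_real c"
    using s2 by (auto simp: Rp_def Rm_def field_simps power2_eq_square)
  \<comment> \<open>For \<open>c = 0\<close> the number \<open>b / s\<close> would be 1 or -1, a
    singularity of \<open>artanh\<close>.\<close>
  have R0: "Rp \<noteq> 0" "Rm \<noteq> 0" using R c by auto
  have lim: "(q \<longlongrightarrow> 1) (nhds 0)" "((\<lambda>t::real. 1 - of_real t * Rm) \<longlongrightarrow> 1) (nhds 0)"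
    "((\<lambda>t::real. 1 - of_real t * Rp) \<longlongrightarrow> 1) (nhds 0)"
    unfolding q_def by (rule isCont_imp_tendsto_nhds; auto intro!: continuous_intros)+
  have nz: "\<forall>\<^sub>F t in nhds 0. 1 - of_real t * Rm \<in> - {0}" "\<forall>\<^sub>F t in nhds 0. 1 - of_real t * Rp \<in> - {0}"
    by (rule topological_tendstoD[OF lim(2)] topological_tendstoD[OF lim(3)]; simp add: open_Compl)+
  have k0: "k \<noteq> 0" using R0 by (simp add: k_def)
  \<comment> \<open>The principal logarithm of \<open>k * q t\<close> splits if the two arguments
    add up within (-pi, pi].\<close>
  have im: "\<forall>\<^sub>F t in nhds 0. - pi < Im (ln k) + Im (ln (q t)) \<and> Im (ln k) + Im (ln (q t)) \<le> pi"
  proof (cases "b\<^sup>2 > 4 * c")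
    case True
    then obtain s' where s': "s = of_real s'"
      by (auto simp: s_def csqrt_of_real_nonneg)
    have "q t \<in> \<real>" for t
      unfolding q_def Rp_def Rm_def s'
      by (intro Reals_divide Reals_diff Reals_add Reals_mult Reals_of_real Reals_1 Reals_numeral)
    hence qr: "q t = of_real (Re (q t))" for t by (simp add: of_real_Re)
    have "((\<lambda>t. Re (q t)) \<longlongrightarrow> 1) (nhds 0)" using tendsto_Re[OF lim(1)] by simp
    hence "\<forall>\<^sub>F t in nhds 0. Re (q t) > 0" by (rule order_tendstoD) simp
    thus ?thesis
    proof eventually_elim
      case (elim t)
      have "Im (ln (q t)) = 0" by (subst qr) (use elim in \<open>simp add: Ln_of_real\<close>)
      thus ?case using k0 by (simp add: mpi_less_Im_Ln Im_Ln_le_pi)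
    qed
  next
    case nonpos: False
    then obtain r where r: "s = \<i> * of_real r" and "r \<noteq> 0"
      using False by (auto simp: s_def csqrt_of_real_nonpos)
    \<comment> \<open>For imaginary \<open>s\<close>, the imaginary parts of
      \<open>- Rp = x * Rm\<close> force \<open>x = 1\<close>, against
      \<open>x \<le> 0\<close>.\<close>
    have "k \<notin> \<real>\<^sub>\<le>\<^sub>0"
    proof
      assume "k \<in> \<real>\<^sub>\<le>\<^sub>0"
      then obtain x where x: "x \<le> 0" "k = of_real x" by (auto elim: nonpos_Reals_cases)
      hence "- Rp = of_real x * Rm" using R0 by (simp add: k_def field_simps)
      hence "- b = x * b" "- r = - (x * r)"
        by (auto simp: Rp_def Rm_def r complex_eq_iff)
      thus False using x \<open>r \<noteq> 0\<close> by simp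
    qed
    hence bounds: "Im (ln k) < pi" "- pi < Im (ln k)"
      using k0 Im_Ln_eq_pi[of k] Im_Ln_le_pi[of k] mpi_less_Im_Ln[of k]
      by (auto simp: complex_nonpos_Reals_iff less_le)
    have "((\<lambda>t. Im (ln k) + Im (ln (q t))) \<longlongrightarrow> Im (ln k) + Im (ln 1)) (nhds 0)"
      by (intro tendsto_intros lim) auto
    hence "((\<lambda>t. Im (ln k) + Im (ln (q t))) \<longlongrightarrow> Im (ln k)) (nhds 0)" by simp
    from order_tendstoD(1)[OF this bounds(2)] order_tendstoD(2)[OF this bounds(1)]
    show ?thesis by eventually_elim simp
  qed
  show ?thesis
    using nz im
  proof eventually_elim
    case (elim t)
    have frac: "(1 + x / s) / (1 - x / s) = (s + x) / (s - x)" for x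
    proof -
      have "1 + x / s = (s + x) / s" "1 - x / s = (s - x) / s"
        using s by (simp_all add: add_divide_distrib diff_divide_distrib)
      thus ?thesis using s by simp
    qed
    have q0: "q t \<noteq> 0" using elim by (auto simp: q_def)
    have "artanh ((of_real b - 2 * of_real c * of_real t) / s) = ln (k * q t) / 2"
    proof -
      \<comment> \<open>Both terms of the fraction factor because \<open>s + b = 2 * Rp\<close>,
        \<open>s - b = - 2 * Rm\<close> and \<open>c = Rp * Rm\<close>.\<close>
      note frac[of "of_real b - 2 * of_real c * of_real t"]
      also have "s + (of_real b - 2 * of_real c * of_real t) = 2 * Rp * (1 - of_real t * Rm)"
        unfolding R[symmetric] by (simp add: Rp_def field_simps)
      also have "s - (of_real b - 2 * of_real c * of_real t) = - 2 * Rm * (1 - of_real t * Rp)"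
        unfolding R[symmetric] by (simp add: Rm_def field_simps)
      finally show ?thesis using R0 by (simp add: artanh_def k_def q_def)
    qed
    moreover have "artanh (of_real b / s) = ln k / 2"
    proof -
      have "(1 + of_real b / s) / (1 - of_real b / s) = k"
        using s R0 by (simp add: k_def Rp_def Rm_def field_simps)
      thus ?thesis by (simp add: artanh_def)
    qed
    moreover have "ln (k * q t) = ln k + ln (q t)"
      using k0 q0 elim by (intro Ln_times_simple) auto
    ultimately show ?case
      unfolding artanh_form_def log_form_def Let_def if_not_P[OF False] s_def[symmetric]
        Rp_def[symmetric] Rm_def[symmetric]
      by (simp add: q_def field_simps)
  qed
qed

theorem theorem5:
  fixes f :: "real fps" and \<Psi> :: "nat \<Rightarrow> real poly"
    and A B C :: "nat \<Rightarrow> real" and a b :: real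
  assumes gen: "\<And>x. fps_exponential (fps_const x * f) = Abs_fps (\<lambda>n. poly (\<Psi> n) x / fact n)"
    and rec: "three_term_recurrence \<Psi> A B C"
    and a: "a = fps_nth (fps_deriv f) 0" and a_nz: "a \<noteq> 0"
    and b: "b = fps_nth (fps_deriv (fps_deriv f)) 0 / fps_nth (fps_deriv f) 0"
  shows "\<exists>c. (\<forall>n. A n = a) \<and> (\<forall>n. B n = real n * b)
           \<and> (\<forall>n\<ge>1. C n = c * real n * (real n - 1))
           \<and> three_term_recurrence \<Psi> (\<lambda>n. a) (\<lambda>n. real n * b) (\<lambda>n. c * real n * (real n - 1))
           \<and> (c > 0 \<longleftrightarrow> (\<forall>n\<ge>2. C n > 0))
           \<and> (c \<noteq> 0 \<longrightarrow> equals_near_0 f (artanh_form a b c))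
           \<and> (b \<noteq> 0 \<or> c \<noteq> 0 \<longrightarrow> equals_near_0 f (log_form a b c))
           \<and> (b = 0 \<and> c = 0 \<longrightarrow> f = fps_const a * fps_X)"
proof -
  have \<Psi>0: "\<Psi> 0 = 1" using rec by (simp add: three_term_recurrence_def)
  \<comment> \<open>The constant coefficient at \<open>x = 1\<close> reads
    \<open>exp (fps_nth f 0) = 1\<close>.\<close>
  have f0: "fps_nth f 0 = 0"
    using arg_cong[OF gen[of 1], of "\<lambda>g. fps_nth g 0"] by (simp add: fps_exponential_def \<Psi>0)
  have f1: "fps_nth f 1 = a" using a by simp
  have f2: "fps_nth f 2 = a * b / 2"
    using b a_nz by (simp add: a numeral_2_eq_2 field_simps)
  note coeff_\<Psi> = coeff_of_generating_function[OF gen f0]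

  \<comment> \<open>The three highest coefficients of the polynomials\<close>
  define g where "g = fps_shift 1 f"
  have f_eq: "f = g * fps_X"
    by (rule fps_ext) (auto simp: g_def f0)
  \<comment> \<open>The coefficient of \<open>\<Psi> (m + j)\<close> that lies \<open>j\<close>
    places below the top thus depends only on the first \<open>j + 1\<close> coefficients of
    \<open>g\<close>.\<close>
  have pow: "fps_nth (f ^ m) (m + j) = fps_nth (g ^ m) j" for m j
    by (simp add: f_eq power_mult_distrib fps_X_power_mult_right_nth)
  have g: "fps_nth g 0 = a" "fps_nth g 1 = a * b / 2" "fps_nth g 2 = fps_nth f 3"
    using f1 f2 by (simp_all add: g_def eval_nat_numeral)
  \<comment> \<open>The value that the differential equation forces in degree 2.\<close>
  define c where "c = b\<^sup>2 - 3 * fps_nth f 3 / a"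
  have lead: "coeff (\<Psi> n) n = a ^ n" for n
    using pow[of n 0] by (simp add: coeff_\<Psi> g fps_power_zeroth)
  have sub: "coeff (\<Psi> (Suc n)) n = real (Suc n) * (real n * a ^ n * b / 2)" for n
  proof -
    have "fps_nth (g ^ n) 1 = real n * a ^ n * b / 2"
      using fps_power_nth_1_mult[of g n] a_nz by (simp add: g del: One_nat_def)
    thus ?thesis using pow[of n 1] by (simp add: coeff_\<Psi>)
  qed
  have subsub: "coeff (\<Psi> (Suc (Suc n))) n = real (Suc n) * real (Suc (Suc n)) * a ^ n *
      (real n * (b\<^sup>2 - c) / 3 + real n * (real n - 1) / 8 * b\<^sup>2)" for n
  proof -
    have "fps_nth f 3 = a * (b\<^sup>2 - c) / 3" using a_nz by (simp add: c_def)
    note g = g(1,2) g(3)[unfolded this]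
    hence "fps_nth (g ^ n) 2 * a\<^sup>2 = a ^ n *
        (real n * (b\<^sup>2 - c) / 3 + real n * (real n - 1) / 8 * b\<^sup>2) * a\<^sup>2"
      using fps_power_nth_2_mult[of g n] unfolding g by (simp add: field_simps power2_eq_square)
    hence "fps_nth (g ^ n) 2 = a ^ n *
        (real n * (b\<^sup>2 - c) / 3 + real n * (real n - 1) / 8 * b\<^sup>2)"
      using a_nz by simp
    thus ?thesis using pow[of n 2] by (simp add: coeff_\<Psi>)
  qed
  have vanish: "coeff (\<Psi> n) i = 0" if "i > n" for n i
    using that f0 by (simp add: coeff_\<Psi> startsby_zero_power_prefix)
  note rec_coeff = three_term_recurrence_coeff[OF rec]

  \<comment> \<open>The coefficients of the recurrence\<close>
  have \<Psi>1: "\<Psi> (Suc 0) = [:B 0, A 0:]"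
    using rec by (auto simp: three_term_recurrence_def)
  have A: "A n = a" for n
  proof (cases n)
    case 0
    thus ?thesis using lead[of 1] \<Psi>1 by simp
  next
    case (Suc m)
    thus ?thesis using rec_coeff[of m "Suc m"] a_nz by (simp add: lead vanish)
  qed
  have B: "B n = real n * b" for n
  proof (cases n)
    case 0
    thus ?thesis using sub[of 0] \<Psi>1 by simp
  next
    case (Suc m)
    \<comment> \<open>At \<open>x ^ Suc m\<close> the \<open>C\<close> term drops out, as
      \<open>\<Psi> m\<close> has degree at most \<open>m\<close>.\<close>
    have "real (Suc (Suc m)) * (real (Suc m) * a ^ Suc m * b / 2)
      = a * (real (Suc m) * (real m * a ^ m * b / 2)) + B n * a ^ Suc m"
      using rec_coeff[of m m] by (simp only: lead sub vanish A Suc lessI)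
    hence "a ^ Suc m * B n = a ^ Suc m * (real n * b)"
      by (simp add: Suc field_simps)
    thus ?thesis using a_nz by simp
  qed
  have C: "C (Suc m) = c * real (Suc m) * real m" for m
  proof (cases m)
    case 0
    \<comment> \<open>Here the constant terms have to be compared, which \<open>rec_coeff\<close>
      does not cover: those of \<open>\<Psi> 1\<close> and \<open>\<Psi> 2\<close> vanish and that
      of \<open>\<Psi> 0\<close> is 1, so \<open>C 1 = 0\<close>.\<close>
    have "coeff (\<Psi> n) 0 = 0" if "n > 0" for n using that by (simp add: coeff_\<Psi>)
    moreover have "coeff (\<Psi> (Suc (Suc 0))) 0 = B 1 * coeff (\<Psi> (Suc 0)) 0 - C 1 * coeff (\<Psi> 0) 0"
      using rec by (simp add: three_term_recurrence_def)
    ultimately show ?thesis using 0 by (simp add: \<Psi>0)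
  next
    case (Suc k)
    have "real (Suc (Suc k)) * real (Suc (Suc (Suc k))) * a ^ Suc k *
      (real (Suc k) * (b\<^sup>2 - c) / 3 + real (Suc k) * (real (Suc k) - 1) / 8 * b\<^sup>2)
      = a * (real (Suc k) * real (Suc (Suc k)) * a ^ k *
      (real k * (b\<^sup>2 - c) / 3 + real k * (real k - 1) / 8 * b\<^sup>2))
      + real (Suc m) * b * (real (Suc (Suc k)) * (real (Suc k) * a ^ Suc k * b / 2)) - C (Suc m) * a ^ Suc k"
      using rec_coeff[of "Suc k" k] by (simp only: lead sub subsub A B Suc)
    hence "a ^ Suc k * C (Suc m) = a ^ Suc k * (c * real (Suc m) * real m)"
      unfolding Suc by (simp add: field_simps power2_eq_square) 
    thus ?thesis using a_nz by simp
  qed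
  \<comment> \<open>In the recurrence \<open>C 0\<close> multiplies the polynomial of index -1,
    which is 0, so its value stays open.\<close>
  have C': "C n = c * real n * (real n - 1)" if "n \<ge> 1" for n
    using that C[of "n - 1"] by (simp add: of_nat_diff)
  have rec': "three_term_recurrence \<Psi> (\<lambda>n. a) (\<lambda>n. real n * b) (\<lambda>n. c * real n * (real n - 1))"
    unfolding three_term_recurrence_def
  proof (intro conjI allI)
    fix n
    show "\<Psi> (Suc n) = [:real n * b, a:] * \<Psi> n -
        smult (c * real n * (real n - 1)) (case n of 0 \<Rightarrow> 0 | Suc m \<Rightarrow> \<Psi> m)"
      using rec C'[of n] by (cases n) (simp_all add: three_term_recurrence_def A B)
  qed (rule \<Psi>0)
  have pos: "c > 0 \<longleftrightarrow> (\<forall>n\<ge>2. C n > 0)"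
  proof
    assume "\<forall>n\<ge>2. C n > 0"
    hence "C 2 > 0" by simp
    thus "c > 0" by (simp add: C')
  qed (auto simp: C')

  \<comment> \<open>The differential equation for \<open>f\<close>\<close>
  define P where "P = 1 - fps_const b * fps_X + fps_const c * fps_X\<^sup>2"
  have ode: "fps_deriv f * P = fps_const a"
  proof (rule fps_ext)
    fix n
    let ?d = "fps_deriv f"
    have P': "?d * P = ?d - fps_const b * (?d * fps_X) + fps_const c * (?d * fps_X ^ 2)"
      by (simp add: P_def algebra_simps)
    have coeff1: "coeff (\<Psi> n) 1 = fact n * fps_nth f n" for n by (simp add: coeff_\<Psi>)
    \<comment> \<open>Degrees 0 and 1 express the choice of \<open>a\<close> and \<open>b\<close>;
      the \<open>c\<close> term enters from degree 2.\<close>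
    consider "n = 0" | "n = 1" | k where "n = Suc (Suc k)"
      by (metis One_nat_def not0_implies_Suc)
    thus "fps_nth (?d * P) n = fps_nth (fps_const a) n"
    proof cases
      case 1
      thus ?thesis using f1 by (simp add: P')
    next
      case 2
      thus ?thesis using f1 f2
        by (simp add: P' fps_X_power_mult_right_nth numeral_2_eq_2) (simp add: mult.commute)
    next
      case (3 k)
      \<comment> \<open>The \<open>A\<close> term contributes the constant term of
        \<open>\<Psi> n\<close>, which is 0. Every other term contains
        \<open>fact n = real n * fact (Suc k)\<close>, which is cancelled below.\<close>
      have "fact (Suc n) * fps_nth f (Suc n) = real n * b * (fact n * fps_nth f n)
          - c * real n * real (Suc k) * (fact (Suc k) * fps_nth f (Suc k))"
        using rec_coeff[of "Suc k" 0] 3 B[of n] C[of "Suc k"]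
        by (simp add: coeff1[unfolded One_nat_def] coeff_\<Psi>[of _ 0] del: fact_Suc of_nat_Suc)
      moreover have "fact n = real n * fact (Suc k)" "fact (Suc n) = real (Suc n) * (real n * fact (Suc k))"
        using 3 by simp_all
      ultimately have "(real n * fact (Suc k)) * (real (Suc n) * fps_nth f (Suc n))
          = (real n * fact (Suc k)) * (b * (real n * fps_nth f n) - c * (real (Suc k) * fps_nth f (Suc k)))"
        by (simp add: algebra_simps del: fact_Suc of_nat_Suc)
      hence "real (Suc n) * fps_nth f (Suc n) = b * (real n * fps_nth f n) - c * (real (Suc k) * fps_nth f (Suc k))"
        using 3 by (simp only: mult_left_cancel) simp
      thus ?thesis using 3
        by (simp add: P' fps_X_power_mult_right_nth del: of_nat_Suc)
    qed
  qed
  have P_rad: "fps_conv_radius P = \<infinity>"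
  proof -
    have "fps_conv_radius P \<ge> \<infinity>"
      unfolding P_def
      by (rule order_trans[OF _ fps_conv_radius_add] order_trans[OF _ fps_conv_radius_diff]
          order_trans[OF _ fps_conv_radius_mult] min.boundedI | simp)+
    thus ?thesis by simp
  qed
  have P_eval: "eval_fps P t = 1 - b * t + c * t\<^sup>2" for t
  proof -
    have "P = fps_of_poly [:1, - b, c:]"
      by (simp add: P_def fps_of_poly_pCons algebra_simps power2_eq_square flip: fps_const_neg)
    thus ?thesis by (simp add: algebra_simps power2_eq_square)
  qed

  \<comment> \<open>The closed forms of \<open>f\<close>\<close>
  have log: "equals_near_0 f (log_form a b c)" if "b \<noteq> 0 \<or> c \<noteq> 0"
    using log_form_derivative[OF that, of a]
    by (intro equals_near_0I[OF ode _ _ f0, where p = "\<lambda>z. 1 - of_real b * z + of_real c * z\<^sup>2"])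
      (simp_all add: P_rad P_eval, simp_all add: P_def log_form_def Let_def)
  have artanh: "equals_near_0 f (artanh_form a b c)" if "c \<noteq> 0"
  proof -
    have "\<forall>\<^sub>F t in nhds 0. complex_of_real (eval_fps f t) = log_form a b c (of_real t)"
      using log that by (simp add: equals_near_0_def)
    hence "\<forall>\<^sub>F t in nhds 0. complex_of_real (eval_fps f t) = artanh_form a b c (of_real t)"
      using artanh_form_eq_log_form[OF that, of a b] by eventually_elim simp
    thus ?thesis using log that by (simp add: equals_near_0_def)
  qed
  have lin: "f = fps_const a * fps_X" if "b = 0" "c = 0"
  proof -
    have "fps_deriv f = fps_deriv (fps_const a * fps_X)"
      using ode that by (simp add: P_def)
    thus ?thesis unfolding fps_deriv_eq_iff by (simp add: f0)
  qed
  show ?thesis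
    using A B C' rec' pos artanh log lin by (intro exI[of _ c]) simp
qed

end
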